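(* Let $d\ge 2$ and let $f_d$ be a depth-$d$ network with weight matrices $W_1,\dots,W_d$, where $W_i$ has $n_i$ columns, and suppose the network is dense, i.e. every entry of every $W_i$ is nonzero. Let $G_d$ be the computational graph of $f_d$. For $i=1,\dots,n_d$ define $$I_i:=\{s_{(d-1,i)}\}\cup\{s_{(j,k)} : \text{there exists a directed path from } s_{(j,k)} \text{ to } s_{(d-1,i)} \text{ in } G_d\}.$$ Then the sequence $\{I_i\}_{i=1}^{n_d}$ is a valid sparsity pattern for the norm-gradient polynomial of the network $f_d$.
   Context: Network. Let $n_1,\dots,n_d\ge 1$ be integers and set $n_{d+1}=1$. For $i=1,\dots,d$, $W_i$ is a real matrix of size $n_{i+1}\times n_i$. The network is $f_1(x)=W_1x$, $f_i(x)=W_i\,\sigma(f_{i-1}(x))$ for $i=2,\dots,d$, with $\sigma$ an activation function applied element-wise, so $f_d$ is real-valued. Put $n=n_1+\dots+n_d$. Norm-gradient polynomial. For $i=0,\dots,d-1$ let $s_i=(s_{(i,1)},\dots,s_{(i,n_{i+1})})$ be a vector of $n_{i+1}$ variables (so $s_0$ corresponds to the input layer and $s_1,\dots,s_{d-1}$ to the hidden layers). The norm-gradient polynomial of $f_d$ is the polynomial in the $n$ variables $x=[s_0,\dots,s_{d-1}]$ $$p(x)=(2s_0-\mathbf 1)^T W_1^T\prod_{i=1}^{d-1}\mathrm{Diag}(s_i)\,W_{i+1}^T ,$$ where $\mathbf 1$ is the all-ones vector, $\mathrm{Diag}(v)$ is the diagonal matrix with diagonal $v$, and the product is taken in order of increasing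 $i$ from left to right. (It is the polynomial $t^TW_1^T\prod_{i=1}^{d-1}\mathrm{Diag}(s_i)W_{i+1}^T$ after the substitution $t=2s_0-\mathbf 1$.) Computational graph. $G_d=(V,E)$ is the directed graph with vertex set the set of all variables, $V=\{s_{(i,j)}: 0\le i\le d-1,\ 1\le j\le n_{i+1}\}$, and edge set $E=\{(s_{(i,j)},s_{(i+1,k)}): 0\le i\le d-2,\ [W_{i+1}]_{k,j}\ne 0\}$. Valid sparsity pattern. Let $p$ be a polynomial in variables indexed by a finite set $I$ (here we identify the index set with the set $V$ of variables). A valid sparsity pattern of $p$ is a sequence $\{I_i\}_{i=1}^m$ of subsets of $I$ (called cliques) such that $\bigcup_{i=1}^m I_i=I$ and: (1) $p=\sum_{i=1}^m p_i$, where each $p_i$ is a polynomial depending only on the variables indexed by $I_i$; (2) for all $i=1,\dots,m-1$ there is an $l\le i$ such that $\bigl(I_{i+1}\cap\bigcup_{r=1}^i I_r\bigr)\subseteq I_l$. *)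

theory Defs
  imports
    "HOL-Library.Poly_Mapping"
    "Jordan_Normal_Form.Matrix"
    "Graph_Theory.Graph_Theory"
begin

text \<open>
  Real polynomials in the variables \<open>'v\<close>: a monomial is a finitely supported exponent
  function, and a polynomial is a finitely supported function from monomials to coefficients.
  The ring structure is the convolution product
  of \<^theory>\<open>HOL-Library.Poly_Mapping\<close>.
\<close>

type_synonym 'v rpoly = "('v \<Rightarrow>\<^sub>0 nat) \<Rightarrow>\<^sub>0 real"

definition PConst :: "real \<Rightarrow> 'v rpoly" where
  "PConst c = Poly_Mapping.single 0 c"

definition PVar :: "'v \<Rightarrow> 'v rpoly" where
  "PVar v = Poly_Mapping.single (Poly_Mapping.single v 1) 1"

definition pvars :: "'v rpoly \<Rightarrow> 'v set" where
  "pvars p = (\<Union>m\<in>Poly_Mapping.keys p. Poly_Mapping.keys m)"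

definition valid_sparsity_pattern ::
    "'v set \<Rightarrow> 'v rpoly \<Rightarrow> nat \<Rightarrow> (nat \<Rightarrow> 'v set) \<Rightarrow> bool" where
  "valid_sparsity_pattern I p m C \<longleftrightarrow>
     finite I \<and> pvars p \<subseteq> I \<and>
     (\<Union>i\<in>{1..m}. C i) = I \<and>
     (\<exists>q :: nat \<Rightarrow> 'v rpoly. p = (\<Sum>i=1..m. q i) \<and> (\<forall>i\<in>{1..m}. pvars (q i) \<subseteq> C i)) \<and>
     (\<forall>i\<in>{1..<m}. \<exists>l\<in>{1..i}. C (i + 1) \<inter> (\<Union>r\<in>{1..i}. C r) \<subseteq> C l)"

text \<open>
  Layers are counted from \<open>1\<close>: \<open>width N i\<close> is the number of columns of \<open>weight N i\<close>
  for \<open>1 \<le> i \<le> depth N\<close>; the values of both fields at other indices are irrelevant, except that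
  \<open>width N (depth N + 1)\<close> is the output dimension.
\<close>

record network =
  depth :: nat
  width :: "nat \<Rightarrow> nat"
  weight :: "nat \<Rightarrow> real mat"
  activation :: "real \<Rightarrow> real"

definition is_network :: "network \<Rightarrow> bool" where
  "is_network N \<longleftrightarrow>
     depth N \<ge> 1 \<and>
     (\<forall>i\<in>{1..depth N}. width N i \<ge> 1) \<and> width N (depth N + 1) = 1 \<and>
     (\<forall>i\<in>{1..depth N}. weight N i \<in> carrier_mat (width N (i + 1)) (width N i))"

fun layer :: "network \<Rightarrow> nat \<Rightarrow> real Matrix.vec \<Rightarrow> real Matrix.vec" where
  "layer N 0 x = x"
| "layer N (Suc 0) x = weight N 1 *\<^sub>v x"
| "layer N (Suc (Suc i)) x =
     weight N (Suc (Suc i)) *\<^sub>v map_vec (activation N) (layer N (Suc i) x)"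

definition network_fun :: "network \<Rightarrow> real Matrix.vec \<Rightarrow> real" where
  "network_fun N x = layer N (depth N) x $ 0"

definition dense :: "network \<Rightarrow> bool" where
  "dense N \<longleftrightarrow>
     (\<forall>i\<in>{1..depth N}. \<forall>k<width N (i + 1). \<forall>j<width N i. weight N i $$ (k, j) \<noteq> 0)"

text \<open>
  The pair \<open>(i, j)\<close> stands for the variable \<open>s\<^sub>(\<^sub>i\<^sub>,\<^sub>j\<^sub>)\<close> with \<open>0 \<le> i \<le> d - 1\<close> and
  \<open>1 \<le> j \<le> n\<^sub>i\<^sub>+\<^sub>1\<close>. Since vectors and matrices are indexed from \<open>0\<close>, the variable \<open>(i, j)\<close>
  belongs to the vector entry with index \<open>j - 1\<close>.
\<close>

type_synonym svar = "nat \<times> nat"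

definition network_vars :: "network \<Rightarrow> svar set" where
  "network_vars N = {(i, j). i < depth N \<and> 1 \<le> j \<and> j \<le> width N (i + 1)}"

definition svec :: "network \<Rightarrow> nat \<Rightarrow> svar rpoly Matrix.vec" where
  "svec N i = Matrix.vec (width N (i + 1)) (\<lambda>j. PVar (i, j + 1))"

definition weightT :: "network \<Rightarrow> nat \<Rightarrow> svar rpoly mat" where
  "weightT N i = map_mat PConst (transpose_mat (weight N i))"

definition input_row :: "network \<Rightarrow> svar rpoly mat" where
  "input_row N =
     mat_of_row (2 \<cdot>\<^sub>v svec N 0 - Matrix.vec (width N 1) (\<lambda>_. 1))"

definition hidden_product :: "network \<Rightarrow> svar rpoly mat" where
  "hidden_product N =
     foldl (\<lambda>M i. M * (mat_diag (width N (i + 1)) (($) (svec N i)) * weightT N (i + 1)))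
       (1\<^sub>m (width N 2)) [1..<depth N]"

text \<open>
  The matrix product has one row and \<open>width N (depth N + 1) = 1\<close> column; the polynomial is its
  only entry.
\<close>

definition norm_gradient_poly :: "network \<Rightarrow> svar rpoly" where
  "norm_gradient_poly N = (input_row N * weightT N 1 * hidden_product N) $$ (0, 0)"

definition comp_graph :: "network \<Rightarrow> (svar, svar \<times> svar) pre_digraph" where
  "comp_graph N =
     \<lparr> verts = network_vars N,
       arcs = {((i, j), (i + 1, k)) | i j k.
                 (i, j) \<in> network_vars N \<and> (i + 1, k) \<in> network_vars N \<and>
                 weight N (i + 1) $$ (k - 1, j - 1) \<noteq> 0},
       tail = fst,
       head = snd \<rparr>"

text \<open>
  The walks of \<^const>\<open>pre_digraph.apath\<close> include the empty one at a vertex.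
  It adds nothing here, since the end vertex \<open>(depth N - 1, i)\<close> is in the clique anyway.
\<close>

definition clique :: "network \<Rightarrow> nat \<Rightarrow> svar set" where
  "clique N i =
     {(depth N - 1, i)} \<union>
     {v. \<exists>p. pre_digraph.apath (comp_graph N) v p (depth N - 1, i)}"

end

theory Submission
  imports Defs
begin

text \<open>
  In a dense network every vertex outside the last layer reaches every vertex of the last layer,
  while no arc joins two vertices of the last layer. Hence the clique of \<open>s\<^sub>(\<^sub>d\<^sub>-\<^sub>1\<^sub>,\<^sub>i\<^sub>)\<close> consists
  of this variable and all variables of the earlier layers, and any two cliques intersect exactly
  in the earlier layers. Expanding the last matrix product writes the polynomial as a sum over
  the last layer, whose \<open>i\<close>-th term is a polynomial in the earlier layers times
  \<open>s\<^sub>(\<^sub>d\<^sub>-\<^sub>1\<^sub>,\<^sub>i\<^sub>)\<close>.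
\<close>

section \<open>Variables occurring in sums and products of polynomials\<close>

lemma pvars_PConst: "pvars (PConst c) = {}"
  by (auto simp: pvars_def PConst_def)

lemma pvars_PVar: "pvars (PVar v) = {v}"
  by (auto simp: pvars_def PVar_def)

lemma pvars_0: "pvars 0 = {}"
  by (simp add: pvars_def)

lemma pvars_1: "pvars 1 = {}"
  by (simp add: pvars_def)

lemma pvars_add: "pvars (p + q) \<subseteq> pvars p \<union> pvars q"
  using keys_add[of p q] by (auto simp: pvars_def)

lemma pvars_uminus: "pvars (- p) = pvars p"
  by (simp add: pvars_def)

lemma pvars_diff: "pvars (p - q) \<subseteq> pvars p \<union> pvars q"
  using pvars_add[of p "- q"] by (simp add: pvars_uminus)

text \<open>Every monomial of a product is a sum of exponent functions, one from each factor.
  Cancellation of coefficients can only remove monomials, hence an inclusion.\<close>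

lemma pvars_mult: "pvars (p * q) \<subseteq> pvars p \<union> pvars q"
proof
  fix v assume "v \<in> pvars (p * q)"
  then obtain m where m: "m \<in> Poly_Mapping.keys (p * q)" "v \<in> Poly_Mapping.keys m"
    by (auto simp: pvars_def)
  then obtain a b where ab: "m = a + b" "a \<in> Poly_Mapping.keys p" "b \<in> Poly_Mapping.keys q"
    using keys_mult[of p q] by blast
  with m keys_add[of a b] have "v \<in> Poly_Mapping.keys a \<union> Poly_Mapping.keys b"
    by blast
  with ab show "v \<in> pvars p \<union> pvars q"
    by (auto simp: pvars_def)
qed

lemma pvars_sum: "pvars (sum f A) \<subseteq> (\<Union>i\<in>A. pvars (f i))"
proof (induction A rule: infinite_finite_induct)
  case (insert i A)
  then show ?case
    using pvars_add[of "f i" "sum f A"] by auto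
qed (auto simp: pvars_0)

section \<open>Matrices with entries in a given set of variables\<close>

definition entries_in :: "'v rpoly mat \<Rightarrow> 'v set \<Rightarrow> bool" where
  "entries_in A S \<longleftrightarrow> (\<forall>i<dim_row A. \<forall>j<dim_col A. pvars (A $$ (i, j)) \<subseteq> S)"

lemma entries_in_mono: "entries_in A S \<Longrightarrow> S \<subseteq> T \<Longrightarrow> entries_in A T"
  unfolding entries_in_def by blast

lemma entries_in_one: "entries_in (1\<^sub>m n) S"
  by (auto simp: entries_in_def pvars_0 pvars_1)

lemma entries_in_mult:
  assumes "dim_col A = dim_row B" "entries_in A S" "entries_in B S"
  shows "entries_in (A * B) S"
  unfolding entries_in_def
proof (intro allI impI)
  fix i j assume ij: "i < dim_row (A * B)" "j < dim_col (A * B)"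
  then have "(A * B) $$ (i, j) = (\<Sum>k = 0..<dim_row B. A $$ (i, k) * B $$ (k, j))"
    using assms(1) by (simp add: scalar_prod_def)
  moreover have "pvars (A $$ (i, k) * B $$ (k, j)) \<subseteq> S" if "k < dim_row B" for k
    using pvars_mult[of "A $$ (i, k)" "B $$ (k, j)"] assms ij that
    unfolding entries_in_def by fastforce
  ultimately show "pvars ((A * B) $$ (i, j)) \<subseteq> S"
    using pvars_sum[of "\<lambda>k. A $$ (i, k) * B $$ (k, j)" "{0..<dim_row B}"] by fastforce
qed

lemma entries_in_mat_diag:
  assumes "\<And>i. i < n \<Longrightarrow> pvars (f i) \<subseteq> S"
  shows "entries_in (mat_diag n f) S"
  using assms by (auto simp: entries_in_def mat_diag_def pvars_0)

section \<open>Layers of variables in the factors of the norm-gradient polynomial\<close>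

lemma entries_in_weightT: "entries_in (weightT N i) S"
  by (auto simp: entries_in_def weightT_def pvars_PConst)

lemma weightT_carrier:
  "is_network N \<Longrightarrow> i \<in> {1..depth N} \<Longrightarrow>
    weightT N i \<in> carrier_mat (width N i) (width N (i + 1))"
  by (auto simp: is_network_def weightT_def)

text \<open>For \<open>m = depth N - 1\<close> this is the common part of all cliques.\<close>

definition layers_below :: "network \<Rightarrow> nat \<Rightarrow> svar set" where
  "layers_below N m = {v \<in> network_vars N. fst v < m}"

lemma entries_in_svec_diag:
  assumes "i < depth N"
  shows "entries_in (mat_diag (width N (i + 1)) (($) (svec N i))) (layers_below N (i + 1))"
  by (rule entries_in_mat_diag)
     (use assms in \<open>auto simp: svec_def pvars_PVar layers_below_def network_vars_def\<close>)

lemma input_row_carrier: "input_row N \<in> carrier_mat 1 (width N 1)"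
  by (intro carrier_matI) (simp_all add: input_row_def)

lemma entries_in_input_row:
  assumes "is_network N"
  shows "entries_in (input_row N) (layers_below N 1)"
proof -
  have "pvars (2 * PVar (0, j + 1) - 1 :: svar rpoly) \<subseteq> layers_below N 1"
    if "j < width N 1" for j
  proof -
    \<comment> \<open>The numeral is the sum \<open>1 + 1\<close> in the polynomial ring, not an
      instance of \<open>PConst\<close>.\<close>
    have "pvars (2 :: svar rpoly) = {}"
      using pvars_add[of 1 "1 :: svar rpoly"] by (simp add: pvars_1)
    then have "pvars (2 * PVar (0, j + 1) - 1 :: svar rpoly) \<subseteq> {(0, j + 1)}"
      using pvars_diff[of "2 * PVar (0, j + 1)" "1 :: svar rpoly"]
        pvars_mult[of 2 "PVar (0, j + 1) :: svar rpoly"]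
      by (auto simp: pvars_1 pvars_PVar)
    with that assms show ?thesis
      by (auto simp: layers_below_def network_vars_def is_network_def)
  qed
  then show ?thesis
    by (auto simp: entries_in_def input_row_def svec_def mat_of_row_def)
qed

text \<open>Partial products of \<open>hidden_product\<close>, which is the case
  \<open>m = depth N - 1\<close>. They allow induction on the number of factors and splitting off
  the last one.\<close>

definition hidden_prefix :: "network \<Rightarrow> nat \<Rightarrow> svar rpoly mat" where
  "hidden_prefix N m =
     foldl (\<lambda>M i. M * (mat_diag (width N (i + 1)) (($) (svec N i)) * weightT N (i + 1)))
       (1\<^sub>m (width N 2)) [1..<Suc m]"

lemma hidden_prefix_0: "hidden_prefix N 0 = 1\<^sub>m (width N 2)"
  by (simp add: hidden_prefix_def)

lemma hidden_prefix_Suc: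
  "hidden_prefix N (Suc m) =
     hidden_prefix N m *
       (mat_diag (width N (m + 2)) (($) (svec N (Suc m))) * weightT N (m + 2))"
  by (simp add: hidden_prefix_def)

lemma hidden_prefix_carrier:
  assumes "is_network N" "m < depth N"
  shows "hidden_prefix N m \<in> carrier_mat (width N 2) (width N (m + 2))"
  using assms(2)
proof (induction m)
  case 0
  show ?case by (simp add: hidden_prefix_0 numeral_2_eq_2)
next
  case (Suc m)
  then show ?case
    using weightT_carrier[OF assms(1), of "m + 2"]
    by (auto simp: hidden_prefix_Suc intro!: mult_carrier_mat)
qed

text \<open>The factor with index \<open>m\<close> brings in only the variables of layer
  \<open>m\<close>, and the weight matrices are constant.\<close>

lemma entries_in_hidden_prefix:
  assumes "is_network N" "m < depth N"
  shows "entries_in (hidden_prefix N m) (layers_below N (m + 1))"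
  using assms(2)
proof (induction m)
  case 0
  show ?case by (simp add: hidden_prefix_0 entries_in_one)
next
  case (Suc m)
  have W: "weightT N (m + 2) \<in> carrier_mat (width N (m + 2)) (width N (m + 3))"
    using weightT_carrier[OF assms(1), of "m + 2"] Suc.prems by (simp add: eval_nat_numeral)
  have H: "hidden_prefix N m \<in> carrier_mat (width N 2) (width N (m + 2))"
    using hidden_prefix_carrier[OF assms(1)] Suc.prems by simp
  have "entries_in (hidden_prefix N m) (layers_below N (m + 2))"
  proof (rule entries_in_mono)
    show "entries_in (hidden_prefix N m) (layers_below N (m + 1))"
      using Suc by simp
  qed (auto simp: layers_below_def)
  moreover have "entries_in (mat_diag (width N (m + 2)) (($) (svec N (Suc m))))
      (layers_below N (m + 2))"
    using entries_in_svec_diag[of "Suc m" N] Suc.prems by simp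
  ultimately have "entries_in (hidden_prefix N (Suc m)) (layers_below N (m + 2))"
    using W H unfolding hidden_prefix_Suc
    by (intro entries_in_mult entries_in_weightT) (auto simp: mat_diag_def)
  then show ?case by simp
qed

text \<open>Only the last diagonal factor contains variables of the last layer. Depth at least 2
  ensures that this factor exists and that the input row belongs to an earlier layer.\<close>

lemma norm_gradient_poly_expansion:
  assumes N: "is_network N" and d: "depth N \<ge> 2"
  shows "\<exists>a. (\<forall>k. pvars (a k) \<subseteq> layers_below N (depth N - 1)) \<and>
    norm_gradient_poly N = (\<Sum>k = 1..width N (depth N). a k * PVar (depth N - 1, k))"
proof -
  obtain m where m: "depth N = m + 2"
    using d by (metis add.commute le_Suc_ex)
  define n where "n = width N (m + 2)"
  \<comment> \<open>The polynomial is the entry of \<open>R * (D * W)\<close>: the row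
    \<open>R\<close> collects all factors before the last diagonal one.\<close>
  define R where "R = input_row N * weightT N 1 * hidden_prefix N m"
  define D where "D = mat_diag n (($) (svec N (Suc m)))"
  define W where "W = weightT N (m + 2)"
  have H: "hidden_prefix N m \<in> carrier_mat (width N 2) n"
    using hidden_prefix_carrier[OF N, of m] m by (simp add: n_def)
  have W1: "weightT N 1 \<in> carrier_mat (width N 1) (width N 2)"
    using weightT_carrier[OF N, of 1] m by (simp add: numeral_2_eq_2)
  have Wc: "W \<in> carrier_mat n 1"
    using weightT_carrier[OF N, of "m + 2"] m N by (simp add: n_def W_def is_network_def)
  have A: "input_row N * weightT N 1 \<in> carrier_mat 1 (width N 2)"
    using input_row_carrier W1 by (rule mult_carrier_mat)
  have R: "R \<in> carrier_mat 1 n"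
    unfolding R_def using A H by (rule mult_carrier_mat)
  \<comment> \<open>Left multiplication by a diagonal matrix scales rows, so each row of
    \<open>W\<close> receives exactly one variable of the last layer.\<close>
  have DW: "D * W = Matrix.mat n 1 (\<lambda>(i, j). svec N (Suc m) $ i * W $$ (i, j))"
    unfolding D_def using Wc by (rule mat_diag_mult_left)
  have "hidden_product N = hidden_prefix N (Suc m)"
    by (simp add: hidden_product_def hidden_prefix_def m)
  also have "\<dots> = hidden_prefix N m * (D * W)"
    by (simp add: hidden_prefix_Suc D_def W_def n_def)
  finally have "norm_gradient_poly N =
      (input_row N * weightT N 1 * (hidden_prefix N m * (D * W))) $$ (0, 0)"
    by (simp add: norm_gradient_poly_def)
  also have "input_row N * weightT N 1 * (hidden_prefix N m * (D * W)) = R * (D * W)"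
    unfolding R_def using A H by (rule assoc_mult_mat[symmetric]) (unfold DW, rule mat_carrier)
  also have "(R * (D * W)) $$ (0, 0) =
      (\<Sum>k = 0..<n. R $$ (0, k) * (svec N (Suc m) $ k * W $$ (k, 0)))"
    using R by (simp add: DW scalar_prod_def)
  also have "\<dots> = (\<Sum>k = 0..<n. R $$ (0, k) * W $$ (k, 0) * PVar (Suc m, k + 1))"
    by (intro sum.cong) (auto simp: svec_def n_def)
  also have "\<dots> = (\<Sum>k = 1..n. R $$ (0, k - 1) * W $$ (k - 1, 0) * PVar (Suc m, k))"
    by (rule sum.reindex_bij_witness[of _ "\<lambda>k. k - 1" "\<lambda>k. k + 1"]) auto
  finally have eq: "norm_gradient_poly N =
      (\<Sum>k = 1..n. R $$ (0, k - 1) * W $$ (k - 1, 0) * PVar (Suc m, k))" .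
  have "entries_in R (layers_below N (m + 1))"
  proof -
    have "entries_in (input_row N) (layers_below N (m + 1))"
      using entries_in_input_row[OF N] by (rule entries_in_mono) (auto simp: layers_below_def)
    moreover have "entries_in (hidden_prefix N m) (layers_below N (m + 1))"
      using entries_in_hidden_prefix[OF N, of m] m by simp
    ultimately show ?thesis
      unfolding R_def using A H W1 input_row_carrier[of N]
      by (intro entries_in_mult entries_in_weightT) auto
  qed
  then have R_vars: "pvars (R $$ (0, k)) \<subseteq> layers_below N (m + 1)" if "k < n" for k
    using that R unfolding entries_in_def by simp
  have W_vars: "pvars (W $$ (k, 0)) \<subseteq> layers_below N (m + 1)" if "k < n" for k
    using that Wc entries_in_weightT[of N "m + 2" "layers_below N (m + 1)"]
    unfolding entries_in_def W_def[symmetric] by simp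
  \<comment> \<open>Matrix entries out of range are unspecified; the default 0 makes the bound on
    the variables hold for every \<open>k\<close>.\<close>
  define a where "a k = (if k \<in> {1..n} then R $$ (0, k - 1) * W $$ (k - 1, 0) else 0)" for k
  have "pvars (a k) \<subseteq> layers_below N (m + 1)" for k
  proof (cases "k \<in> {1..n}")
    case True
    then have "k - 1 < n" by auto
    then have "pvars (R $$ (0, k - 1) * W $$ (k - 1, 0)) \<subseteq> layers_below N (m + 1)"
      using R_vars W_vars by (intro order.trans[OF pvars_mult] Un_least)
    with True show ?thesis by (simp add: a_def)
  qed (auto simp: a_def pvars_0)
  moreover have "norm_gradient_poly N = (\<Sum>k = 1..n. a k * PVar (Suc m, k))"
    unfolding eq by (intro sum.cong) (simp_all add: a_def)
  ultimately show ?thesis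
    by (intro exI[of _ a]) (simp add: m n_def)
qed

section \<open>Paths in the computational graph and the shape of the cliques\<close>

lemma wf_digraph_comp_graph: "wf_digraph (comp_graph N)"
  by unfold_locales (auto simp: comp_graph_def)

lemma comp_graph_dominatesI:
  assumes "dense N" "(i, j) \<in> network_vars N" "(i + 1, k) \<in> network_vars N"
  shows "(i, j) \<rightarrow>\<^bsub>comp_graph N\<^esub> (i + 1, k)"
proof -
  have "i + 1 \<in> {1..depth N}" "k - 1 < width N (i + 1 + 1)" "j - 1 < width N (i + 1)"
    using assms(2,3) by (auto simp: network_vars_def)
  then have "weight N (i + 1) $$ (k - 1, j - 1) \<noteq> 0"
    using assms(1) unfolding dense_def by blast
  with assms(2,3) have "((i, j), (i + 1, k)) \<in> arcs (comp_graph N)"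
    by (auto simp: comp_graph_def)
  then show ?thesis
    by (force simp: arcs_ends_def arc_to_ends_def comp_graph_def)
qed

lemma dense_reachable:
  assumes "is_network N" "dense N" "(i, j) \<in> network_vars N" "(l, k) \<in> network_vars N" "i < l"
  shows "(i, j) \<rightarrow>\<^sup>*\<^bsub>comp_graph N\<^esub> (l, k)"
  using assms(5,3,4)
\<comment> \<open>The start layer descends from \<open>l - 1\<close>; \<open>j\<close> is
  generalized because the path continues from another vertex of the next layer.\<close>
proof (induction i arbitrary: j rule: strict_inc_induct)
  case (base i)
  then show ?case
    using comp_graph_dominatesI[OF assms(2), of i j k]
      wf_digraph.reachable_adjI[OF wf_digraph_comp_graph] by simp
next
  case (step i)
  \<comment> \<open>Any vertex of the next layer could serve as the intermediate one; index 1 exists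
    because all widths are positive.\<close>
  have "(Suc i, 1) \<in> network_vars N"
    using step.hyps step.prems assms(1) by (auto simp: network_vars_def is_network_def)
  with step show ?case
    using comp_graph_dominatesI[OF assms(2), of i j 1]
      wf_digraph.adj_reachable_trans[OF wf_digraph_comp_graph] by fastforce
qed

text \<open>The empty path stays at its end vertex. Otherwise the first arc leads from
  \<open>v\<close> to a vertex one layer higher, so \<open>v\<close> is not in the last
  layer.\<close>

lemma apath_to_last_layer:
  assumes "pre_digraph.apath (comp_graph N) v p (depth N - 1, i)"
  shows "v = (depth N - 1, i) \<or> v \<in> layers_below N (depth N - 1)"
proof (cases p)
  case Nil
  with assms show ?thesis
    by (simp add: pre_digraph.apath_def pre_digraph.awalk_def pre_digraph.cas.simps)
next
  case (Cons e p')
  with assms have "e \<in> arcs (comp_graph N)" "tail (comp_graph N) e = v"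
    by (auto simp: pre_digraph.apath_def pre_digraph.awalk_def pre_digraph.cas.simps)
  then show ?thesis
    by (auto simp: comp_graph_def layers_below_def network_vars_def)
qed

lemma clique_eq:
  assumes "is_network N" "dense N" "i \<in> {1..width N (depth N)}"
  shows "clique N i = insert (depth N - 1, i) (layers_below N (depth N - 1))"
proof -
  have target: "(depth N - 1, i) \<in> network_vars N"
    using assms(1,3) by (auto simp: network_vars_def is_network_def)
  have "\<exists>p. pre_digraph.apath (comp_graph N) v p (depth N - 1, i)"
    if "v \<in> layers_below N (depth N - 1)" for v
  proof -
    have "(fst v, snd v) \<rightarrow>\<^sup>*\<^bsub>comp_graph N\<^esub> (depth N - 1, i)"
      using that target by (intro dense_reachable assms(1,2)) (simp_all add: layers_below_def)
    then obtain p where "pre_digraph.awalk (comp_graph N) v p (depth N - 1, i)"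
      unfolding wf_digraph.reachable_awalk[OF wf_digraph_comp_graph] prod.collapse by blast
    \<comment> \<open>Reachability yields only a walk; removing its cycles gives the path without
      repeated vertices that \<open>clique\<close> asks for.\<close>
    then show ?thesis
      using wf_digraph.apath_awalk_to_apath[OF wf_digraph_comp_graph] by blast
  qed
  then show ?thesis
    using apath_to_last_layer unfolding clique_def by blast
qed

section \<open>Verification of the sparsity pattern\<close>

lemma finite_network_vars: "finite (network_vars N)"
proof (rule finite_subset)
  show "network_vars N \<subseteq> (SIGMA i:{..<depth N}. {1..width N (i + 1)})"
    by (auto simp: network_vars_def)
qed simp

theorem proposition1:
  fixes N :: network
  assumes "is_network N"
    and "depth N \<ge> 2"
    and "dense N"
  shows "valid_sparsity_pattern (network_vars N) (norm_gradient_poly N)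
           (width N (depth N)) (clique N)"
proof -
  define L where "L = layers_below N (depth N - 1)"
  have cl: "clique N i = insert (depth N - 1, i) L" if "i \<in> {1..width N (depth N)}" for i
    using clique_eq[OF assms(1,3) that] by (simp add: L_def)
  \<comment> \<open>At least one clique must exist for the union to cover the earlier
    layers.\<close>
  have n: "1 \<le> width N (depth N)"
    using assms(1,2) by (auto simp: is_network_def)
  have "(\<Union>i\<in>{1..width N (depth N)}. clique N i) =
      (\<Union>i\<in>{1..width N (depth N)}. insert (depth N - 1, i) L)"
    using cl by simp
  also have "\<dots> = network_vars N"
  proof
    show "(\<Union>i\<in>{1..width N (depth N)}. insert (depth N - 1, i) L) \<subseteq> network_vars N"
      using assms(2) by (auto simp: L_def layers_below_def network_vars_def)
    show "network_vars N \<subseteq> (\<Union>i\<in>{1..width N (depth N)}. insert (depth N - 1, i) L)"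
    proof
      fix v assume v: "v \<in> network_vars N"
      show "v \<in> (\<Union>i\<in>{1..width N (depth N)}. insert (depth N - 1, i) L)"
      proof (cases "fst v < depth N - 1")
        case True
        with v n show ?thesis by (auto simp: L_def layers_below_def)
      next
        case False
        with v have "fst v = depth N - 1"
          by (auto simp: network_vars_def)
        \<comment> \<open>Since \<open>depth N - 1 + 1 = depth N\<close>, the second indices in the
          last layer are exactly the clique indices.\<close>
        with v assms(2) show ?thesis
          by (auto simp: network_vars_def)
      qed
    qed
  qed
  finally have union: "(\<Union>i\<in>{1..width N (depth N)}. clique N i) = network_vars N" .
  obtain a where a: "\<And>k. pvars (a k) \<subseteq> L"
    and p: "norm_gradient_poly N =
      (\<Sum>k = 1..width N (depth N). a k * PVar (depth N - 1, k))"
    using norm_gradient_poly_expansion[OF assms(1,2)] unfolding L_def by blast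
  have q: "pvars (a k * PVar (depth N - 1, k)) \<subseteq> clique N k"
    if "k \<in> {1..width N (depth N)}" for k
    using pvars_mult[of "a k" "PVar (depth N - 1, k)"] a[of k] cl[OF that]
    by (auto simp: pvars_PVar)
  have "pvars (norm_gradient_poly N) \<subseteq> (\<Union>i\<in>{1..width N (depth N)}. clique N i)"
    unfolding p using q by (intro order.trans[OF pvars_sum] UN_mono) auto
  \<comment> \<open>As \<open>r\<close> is at most \<open>i\<close>, the cliques
    \<open>i + 1\<close> and \<open>r\<close> have different last-layer variables and meet inside
    \<open>L\<close>. Every clique contains \<open>L\<close>, so the witness \<open>l = 1\<close>
    works for all \<open>i\<close>.\<close>
  moreover have "clique N (i + 1) \<inter> (\<Union>r\<in>{1..i}. clique N r) \<subseteq> clique N 1"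
    if "i \<in> {1..<width N (depth N)}" for i
  proof -
    have "clique N (i + 1) \<inter> clique N r \<subseteq> L" if "r \<in> {1..i}" for r
      using cl[of "i + 1"] cl[of r] that \<open>i \<in> {1..<width N (depth N)}\<close>
      by auto
    then have "clique N (i + 1) \<inter> (\<Union>r\<in>{1..i}. clique N r) \<subseteq> L"
      by blast
    also have "L \<subseteq> clique N 1"
      using cl[of 1] n by auto
    finally show ?thesis .
  qed
  ultimately show ?thesis
    unfolding valid_sparsity_pattern_def union
    using finite_network_vars p q
    by (intro conjI exI[of _ "\<lambda>k. a k * PVar (depth N - 1, k)"] ballI bexI[of _ 1]) simp_all
qed

end
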